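(* Let $q\ge 2$, $d\ge 2$, $1\le z\le q-1$ be integers with $\gcd(q,z)=1$. Put $c=d+z$ and $s=qd-z$. Let $S_0,\dots,S_{d-1}$ be nonempty subsets of $\mathbb Z_q$, and consider the associated Type II two-choice digraph. Then the family $S_0,\dots,S_{d-1}$ is Type II admissible if and only if there exist $a_0,\dots,a_{d-1}\in\mathbb Z_{\ge0}$ with $a_0+\cdots+a_{d-1}=z$ and $\rho\in\mathbb Z_q$ such that $$S_0\subseteq[\rho,\rho+a_0]_q$$ and $$S_t\subseteq\left[\rho-\sum_{j=1}^t(a_j+1),\ \rho-\sum_{j=1}^t(a_j+1)+a_t\right]_q,\qquad t=1,\dots,d-1 .$$
   Context: $\mathbb Z_m=\mathbb Z/m\mathbb Z$, and $\mathbb Z_d$ is identified with $\{0,\dots,d-1\}$. For $a\in\mathbb Z_q$ and an integer $\ell\in\{1,\dots,q\}$, $[a,a+\ell-1]_q=\{a,a+1,\dots,a+\ell-1\}\subseteq\mathbb Z_q$ (residues mod $q$). The Type II two-choice digraph associated with $S_0,\dots,S_{d-1}\subseteq\mathbb Z_q$ has vertex set $\mathbb Z_d\times\mathbb Z_q$ (second coordinates read modulo $q$) and exactly the following edges: the horizontal edges $(t,i)\to(t,i+1)$ for all $t\in\mathbb Z_d$, $i\in\mathbb Z_q$; the transfer edges $(t,i)\to(t+1,i)$ for $t=0,\dots,d-2$ and $i\in S_t$; and the transfer edges $(d-1,i)\to(0,i+c)$ for $i\in S_{d-1}$. For each $t$, the horizontal edges in block $t$ form a directed $q$-cycle, called a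 horizontal $q$-cycle. A family of nonempty sets $S_0,\dots,S_{d-1}\subseteq\mathbb Z_q$ is Type II admissible if, apart from the $d$ horizontal $q$-cycles, every directed (simple) cycle of this digraph has length exactly $s=qd-z$. *)

theory Defs
  imports "Graph_Theory.Pair_Digraph"
begin

text \<open>
  The residues modulo \<open>q\<close> are represented by \<open>{0..<int q}\<close>, the elements of
  \<open>\<int>\<^sub>d\<close> by \<open>{0..<d}\<close>. A family \<open>S\<^sub>0, \<dots>, S\<^sub>d\<^sub>-\<^sub>1\<close> is a function on \<open>nat\<close> of which only
  the values at \<open>t < d\<close> matter.
\<close>

text \<open>
  The interval \<open>[a, b]\<^sub>q\<close>, for integers \<open>a \<le> b < a + q\<close>. The endpoints may be arbitrary
  integers, only their residues modulo \<open>q\<close> matter as long as \<open>b - a\<close> is fixed.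
\<close>

definition cyc_interval :: "nat \<Rightarrow> int \<Rightarrow> int \<Rightarrow> int set" where
  "cyc_interval q a b = (\<lambda>i. i mod int q) ` {a..b}"

definition horizontal_arcs :: "nat \<Rightarrow> nat \<Rightarrow> (nat \<times> int) rel" where
  "horizontal_arcs q t = {((t, i), (t, (i + 1) mod int q)) | i. i \<in> {0..<int q}}"

definition typeII_digraph ::
  "nat \<Rightarrow> nat \<Rightarrow> nat \<Rightarrow> (nat \<Rightarrow> int set) \<Rightarrow> (nat \<times> int) pair_pre_digraph" where
  "typeII_digraph q d c S =
    \<lparr> pverts = {0..<d} \<times> {0..<int q},
      parcs = (\<Union>t\<in>{0..<d}. horizontal_arcs q t)
        \<union> {((t, i), (t + 1, i)) | t i. t < d - 1 \<and> i \<in> S t}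
        \<union> {((d - 1, i), (0, (i + int c) mod int q)) | i. i \<in> S (d - 1)} \<rparr>"

text \<open>
  Here \<open>pre_digraph.cycle\<close> is the library's notion of a simple directed cycle, given as the
  list of its arcs from some starting vertex. A horizontal \<open>q\<close>-cycle therefore appears as \<open>q\<close>
  lists, all with the same set of arcs, which is why it is recognised by that set.
\<close>

definition typeII_admissible :: "nat \<Rightarrow> nat \<Rightarrow> nat \<Rightarrow> (nat \<Rightarrow> int set) \<Rightarrow> bool" where
  "typeII_admissible q d z S \<longleftrightarrow>
    (\<forall>t<d. S t \<noteq> {} \<and> S t \<subseteq> {0..<int q}) \<and>
    (\<forall>p. pre_digraph.cycle (with_proj (typeII_digraph q d (d + z) S)) p
       \<longrightarrow> \<not> (\<exists>t<d. set p = horizontal_arcs q t)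
       \<longrightarrow> length p = q * d - z)"

end

theory Submission
  imports Defs "HOL-Number_Theory.Cong"
begin

text \<open>
  In the coordinate \<open>u = i + t\<close> every arc advances by \<open>1\<close>, except the transfers from the last
  block, which advance by \<open>z + 1\<close>. The condition on the intervals says that, in a window of
  \<open>z + 1\<close> consecutive residues, \<open>S 0, S 1, \<dots>\<close> occupy successive intervals from top to bottom,
  neighbouring intervals sharing one endpoint.

  If this holds, consider the arcs of a simple cycle as a circulation. In every block all entries lie
  before all exits, hence the net flow through a suitable cut of the block shows that the number of
  visits to the block plus the number of uses of one fixed horizontal arc is at most \<open>1\<close>. So a
  cycle that is not horizontal makes a single round and avoids these arcs, and a potential
  function gives its length.

  Conversely, any choice of one exit per block gives a cycle with one round. Its length is the
  prescribed one only if the cyclic distances between successive exits, measured downwards, add up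
  to at most \<open>z < q\<close>; hence these distances are additive along the blocks. Measuring from an element
  of \<open>S 0\<close> that is farthest from a fixed element of \<open>S (d - 1)\<close>, this separates the sets.
\<close>

section \<open>Closed walks as circulations\<close>

lemma sum_list_pcas:
  fixes \<phi> :: "'a \<Rightarrow> int"
  assumes "pcas u p v"
  shows "(\<Sum>e\<leftarrow>p. \<phi> (snd e) - \<phi> (fst e)) = \<phi> v - \<phi> u"
  using assms by (induction p arbitrary: u) auto

lemma mset_pcas:
  assumes "pcas u p v"
  shows "add_mset v (mset (map fst p)) = add_mset u (mset (map snd p))"
  using assms
proof (induction p arbitrary: u)
  case (Cons e p)
  then have "add_mset v (mset (map fst p)) = add_mset (snd e) (mset (map snd p))" and "fst e = u"
    by auto
  then show ?case
    by (simp add: add_mset_commute[of v])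
qed simp

text \<open>In a closed walk every vertex is a tail as often as it is a head, so simplicity can be
  stated for the tails instead of the vertices after the first. Distinct tails also make the arcs
  distinct, so the cycle can be treated as a set of arcs.\<close>

lemma cycle_with_proj_iff:
  "pre_digraph.cycle (with_proj G) p \<longleftrightarrow>
    (\<exists>u. u \<in> pverts G \<and> set p \<subseteq> parcs G \<and> pcas u p u \<and> distinct (map fst p) \<and> p \<noteq> [])"
proof -
  have "distinct (tl (pawalk_verts u p)) \<longleftrightarrow> distinct (map fst p)" if "pcas u p u" for u
  proof -
    have "tl (pawalk_verts u p) = map snd p"
      using pre_digraph.awalk_verts_conv'[of "with_proj G" u p u] that
      by (simp add: cas_with_proj_eq awalk_verts_with_proj_eq)
    moreover have "mset (map fst p) = mset (map snd p)"
      using mset_pcas[OF that] by simp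
    ultimately show ?thesis
      using mset_eq_imp_distinct_iff by metis
  qed
  then show ?thesis
    unfolding pre_digraph.cycle_def pre_digraph.awalk_def
    by (auto simp: cas_with_proj_eq awalk_verts_with_proj_eq)
qed

text \<open>The increments of a potential telescope around the walk. Each choice of
  \<open>\<phi>\<close> thus yields one conservation law; indicators of vertex sets give flow
  balances across cuts.\<close>

lemma sum_closed_walk:
  fixes \<phi> :: "'a \<Rightarrow> int"
  assumes "pcas u p u" "distinct (map fst p)"
  shows "(\<Sum>e\<in>set p. \<phi> (snd e) - \<phi> (fst e)) = 0"
  using sum_list_pcas[OF assms(1), of \<phi>] assms(2)
  by (simp add: sum_list_distinct_conv_sum_set distinct_map)

text \<open>The capacity bound for the cut argument: a simple cycle leaves a vertex at most
  once.\<close>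

lemma sum_tail_le_1:
  assumes "distinct (map fst p)"
  shows "(\<Sum>e\<in>set p. of_bool (fst e = v) :: int) \<le> 1"
proof -
  have "card (set p \<inter> {e. fst e = v}) \<le> 1"
    using assms unfolding One_nat_def
    by (intro card_le_Suc0_iff_eq[THEN iffD2]) (auto simp: distinct_map inj_on_def)
  then show ?thesis
    by (simp add: of_bool_def sum.If_cases)
qed

lemma pcas_map_fst:
  assumes "pcas u p v" "\<And>e. e \<in> set p \<Longrightarrow> fst (snd e) = fst (fst e)" "e \<in> set p"
  shows "fst (fst e) = fst u"
  using assms
proof (induction p arbitrary: u)
  case (Cons e' p)
  have "fst (snd e') = fst u"
    using Cons.prems(1) Cons.prems(2)[of e'] by auto
  moreover have "fst (fst e) = fst (snd e')" if "e \<in> set p"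
    using Cons.IH[of "snd e'"] Cons.prems that by simp
  ultimately show ?case
    using Cons.prems(1,3) by auto
qed simp

locale typeII =
  fixes q d z :: nat and S :: "nat \<Rightarrow> int set"
  assumes q: "q \<ge> 2" and d: "d \<ge> 2" and z: "z < q"
    and ne: "\<And>t. t < d \<Longrightarrow> S t \<noteq> {}"
    and sub: "\<And>t. t < d \<Longrightarrow> S t \<subseteq> {0..<int q}"
begin

abbreviation "G \<equiv> typeII_digraph q d (d + z) S"

lemma parcs_iff:
  "((t, i), (t', j)) \<in> parcs G \<longleftrightarrow> t < d \<and>
    (t' = t \<and> i \<in> {0..<int q} \<and> j = (i + 1) mod int q
     \<or> t + 1 < d \<and> t' = t + 1 \<and> j = i \<and> i \<in> S t
     \<or> t = d - 1 \<and> t' = 0 \<and> j = (i + int (d + z)) mod int q \<and> i \<in> S t)"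
  using d by (auto simp: typeII_digraph_def horizontal_arcs_def)

end

section \<open>Separated intervals force a single round\<close>

text \<open>Adding \<open>t\<close> to both ends of the interval of block \<open>t\<close> exhibits
  the window: \<open>X\<close> is its top, and each block starts at the depth below \<open>X\<close>
  where the previous one stops.\<close>

locale separated = typeII +
  fixes a :: "nat \<Rightarrow> nat" and X :: int
  assumes sum_a: "(\<Sum>t<d. a t) = z"
    and S_interval: "\<And>t. t < d \<Longrightarrow>
      S t \<subseteq> cyc_interval q (X - int t - (\<Sum>j<Suc t. int (a j))) (X - int t - (\<Sum>j<t. int (a j)))"
begin

definition N :: "nat \<Rightarrow> int" where
  "N t = (\<Sum>j<t. int (a j))"

text \<open>
  \<open>N t\<close> and the coordinate \<open>\<psi>\<close> are chosen such that a transfer leaves block \<open>t\<close> at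
  \<open>\<psi> = q - 1 - g\<close> and enters the next block at \<open>\<psi> = a t - g\<close>, for some \<open>0 \<le> g \<le> a t\<close>.
\<close>

definition \<psi> :: "nat \<times> int \<Rightarrow> int" where
  "\<psi> v = (snd v + int (fst v) - (X + 1 - N (fst v))) mod int q"

lemma N_Suc: "N (Suc t) = N t + int (a t)"
  by (simp add: N_def)

lemma N_d: "N d = int z"
  by (simp add: N_def flip: sum_a)

text \<open>Both terms occur in the sum \<open>z < q\<close>. This places the entries of a block, at
  \<open>\<psi>\<close> at most \<open>a t'\<close>, no later than its exits, at
  \<open>\<psi>\<close> at least \<open>q - 1 - a t\<close>.\<close>

lemma a_add_le:
  assumes "t < d" "t' < d" "t \<noteq> t'"
  shows "int (a t) + int (a t') \<le> int q - 1"
proof -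
  have "a t + a t' = (\<Sum>j\<in>{t, t'}. a j)"
    using assms by simp
  also have "\<dots> \<le> (\<Sum>j<d. a j)"
    by (rule sum_mono2) (use assms in auto)
  finally show ?thesis
    using sum_a z by simp
qed

lemma a_le:
  assumes "t < d"
  shows "int (a t) \<le> int q - 1"
  using a_add_le[OF assms, of "if t = 0 then 1 else 0"] assms d by (cases "t = 0") auto

lemma mod_unique:
  assumes "[x = y] (mod int q)" "0 \<le> y" "y < int q"
  shows "x mod int q = y"
  using assms by (simp add: cong_def)

lemma \<psi>_bounds: "0 \<le> \<psi> v" "\<psi> v < int q"
  using q by (auto simp: \<psi>_def)

lemma exit_cases:
  assumes "t < d" "i \<in> S t"
  obtains g where "0 \<le> g" "g \<le> int (a t)" "\<psi> (t, i) = int q - 1 - g"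
    "\<psi> (Suc t, i) = int (a t) - g"
    "t = d - 1 \<Longrightarrow> \<psi> (0, (i + int (d + z)) mod int q) = int (a t) - g"
proof -
  obtain k where "k \<in> {X - int t - N (Suc t)..X - int t - N t}" and k_mod: "i = k mod int q"
    using subsetD[OF S_interval[OF assms(1)] assms(2)] unfolding cyc_interval_def N_def by blast
  then have k: "X - int t - N (Suc t) \<le> k" "k \<le> X - int t - N t"
    by auto
  \<comment> \<open>The depth of the exit below the upper end of the interval of its block.\<close>
  define g where "g = X - int t - N t - k"
  have ik: "[i = k] (mod int q)"
    by (simp add: k_mod cong_def)
  have g: "0 \<le> g" "g \<le> int (a t)"
    using k by (auto simp: g_def N_Suc)
  have "[i + int t - (X + 1 - N t) = k + int t - (X + 1 - N t)] (mod int q)"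
    using ik by (intro cong_add cong_diff cong_refl)
  moreover have "[k + int t - (X + 1 - N t) = (k + int t - (X + 1 - N t)) + int q] (mod int q)"
    by (simp add: cong_def)
  ultimately have "[i + int t - (X + 1 - N t) = int q - 1 - g] (mod int q)"
    using cong_trans by (fastforce simp: g_def algebra_simps)
  then have 1: "\<psi> (t, i) = int q - 1 - g"
    unfolding \<psi>_def fst_conv snd_conv using g a_le[OF assms(1)] by (intro mod_unique) auto
  have "[i + int (Suc t) - (X + 1 - N (Suc t)) = k + int (Suc t) - (X + 1 - N (Suc t))] (mod int q)"
    using ik by (intro cong_add cong_diff cong_refl)
  then have 2: "\<psi> (Suc t, i) = int (a t) - g"
    unfolding \<psi>_def fst_conv snd_conv using g a_le[OF assms(1)]
    by (intro mod_unique) (auto simp: g_def N_Suc algebra_simps)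
  \<comment> \<open>The shift \<open>d + z\<close> makes up for the block offset \<open>d\<close>
    and the total depth \<open>N d = z\<close>, both of which restart from 0 in block 0; so the
    entry formula is the same as for the other transfers.\<close>
  have 3: "\<psi> (0, (i + int (d + z)) mod int q) = int (a t) - g" if "t = d - 1"
  proof -
    have "d = Suc t"
      using that d by simp
    then have "N (Suc t) = int z"
      using N_d by simp
    then have "int z = N t + int (a t)"
      by (simp add: N_Suc)
    have "[(i + int (d + z)) mod int q + int 0 - (X + 1 - N 0)
        = k + int (d + z) + int 0 - (X + 1 - N 0)] (mod int q)"
      using ik by (intro cong_add cong_diff cong_refl) (simp add: cong_def mod_add_left_eq k_mod)
    moreover have "k + int (d + z) + int 0 - (X + 1 - N 0) = int (a t) - g"
      using \<open>d = Suc t\<close> \<open>int z = N t + int (a t)\<close> by (simp add: g_def N_def)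
    ultimately show ?thesis
      unfolding \<psi>_def fst_conv snd_conv using g a_le[OF assms(1)] by (intro mod_unique) auto
  qed
  show ?thesis
    using that g 1 2 3 by blast
qed

text \<open>The cases differ in their effect on \<open>\<psi>\<close>. The \<open>wrap\<close> arc
  is the fixed horizontal arc of each block whose uses are counted below.\<close>

lemma arc_cases:
  assumes "e \<in> parcs G"
  obtains
    (step) t i j where "t < d" "e = ((t, i), (t, j))" "\<psi> (t, i) < int q - 1" "\<psi> (t, j) = \<psi> (t, i) + 1"
      "i \<in> {0..<int q}" "j = (i + 1) mod int q"
  | (wrap) t i j where "t < d" "e = ((t, i), (t, j))" "\<psi> (t, i) = int q - 1" "\<psi> (t, j) = 0"
      "i \<in> {0..<int q}" "j = (i + 1) mod int q"
  | (transfer) t t' i j g where "t < d" "t' = (if t = d - 1 then 0 else Suc t)" "e = ((t, i), (t', j))"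
      "0 \<le> g" "g \<le> int (a t)" "\<psi> (t, i) = int q - 1 - g" "\<psi> (t', j) = int (a t) - g"
      "i \<in> {0..<int q}"
proof -
  obtain t i t' j where e: "e = ((t, i), (t', j))"
    by (metis surj_pair)
  then have t: "t < d"
    using assms parcs_iff by blast
  consider "t' = t" "i \<in> {0..<int q}" "j = (i + 1) mod int q"
    | "t + 1 < d" "t' = t + 1" "j = i" "i \<in> S t"
    | "t = d - 1" "t' = 0" "j = (i + int (d + z)) mod int q" "i \<in> S t"
    using assms unfolding e parcs_iff by blast
  then show thesis
  proof cases
    case 1
    define x where "x = i + int t - (X + 1 - N t)"
    have \<psi>: "\<psi> (t, i) = x mod int q" "\<psi> (t, j) = (x + 1) mod int q"
      using mod_add_left_eq[of "i + 1" "int q" "int t - (X + 1 - N t)"]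
      by (simp_all add: \<psi>_def x_def 1 algebra_simps)
    have "(x + 1) mod int q = (x mod int q + 1) mod int q"
      by (simp add: mod_add_left_eq)
    then show ?thesis
      using step[of t i j] wrap[of t i j] 1 e t \<psi> \<psi>_bounds[of "(t, i)"] q
      by (cases "x mod int q = int q - 1") auto
  next
    case 2
    then obtain g where "0 \<le> g" "g \<le> int (a t)" "\<psi> (t, i) = int q - 1 - g"
      "\<psi> (Suc t, i) = int (a t) - g"
      using exit_cases t by metis
    then show ?thesis
      using transfer[of t "t + 1" i i g] 2 e t sub[OF t] by auto
  next
    case 3
    then obtain g where "0 \<le> g" "g \<le> int (a t)" "\<psi> (t, i) = int q - 1 - g"
      "\<psi> (0, j) = int (a t) - g"
      using exit_cases t by metis
    then show ?thesis
      using transfer[of t 0 i j g] 3 e t sub[OF t] by auto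
  qed
qed

lemma \<psi>_inj:
  assumes "\<psi> (t, i) = \<psi> (t, j)" "i \<in> {0..<int q}" "j \<in> {0..<int q}"
  shows "i = j"
proof -
  have "[i + int t - (X + 1 - N t) = j + int t - (X + 1 - N t)] (mod int q)"
    using assms(1) by (simp add: \<psi>_def cong_def)
  then have "[i = j] (mod int q)"
    using cong_add_rcancel[of i "int t - (X + 1 - N t)" j "int q"] by (simp add: algebra_simps)
  then show ?thesis
    using assms(2,3) by (simp add: cong_def)
qed

section \<open>Rounds and wraps of a simple closed walk\<close>

context
  fixes p u
  assumes closed: "pcas u p u" and arcs: "set p \<subseteq> parcs G" and dist: "distinct (map fst p)" 
    and nonempty: "p \<noteq> []"
begin

text \<open>The number of rounds of the walk. Since \<open>d \<ge> 2\<close>, no horizontal arc is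
  counted.\<close>

definition last_transfers :: int where
  "last_transfers = (\<Sum>e\<in>set p. of_bool (fst (fst e) = d - 1 \<and> fst (snd e) = 0))"

definition transfers_into :: "nat \<Rightarrow> int" where
  "transfers_into t = (\<Sum>e\<in>set p. of_bool (fst (fst e) \<noteq> t \<and> fst (snd e) = t))"

definition wraps :: "nat \<Rightarrow> int" where
  "wraps t = (\<Sum>e\<in>set p. of_bool (fst (fst e) = t \<and> fst (snd e) = t \<and> \<psi> (fst e) = int q - 1))"

text \<open>For \<open>t > 0\<close> this is the flow balance of the blocks from \<open>t\<close> to
  \<open>d - 1\<close>: they are entered only by transfers into block \<open>t\<close> and left only
  by last transfers.\<close>

lemma transfers_into_eq:
  assumes "t < d"
  shows "transfers_into t = last_transfers"
proof -
  define \<phi> where "\<phi> v = (if t = 0 then 0 else of_bool (fst v \<ge> t) :: int)" for v :: "nat \<times> int"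
  have "of_bool (fst (fst e) \<noteq> t \<and> fst (snd e) = t) = 
    of_bool (fst (fst e) = d - 1 \<and> fst (snd e) = 0) + (\<phi> (snd e) - \<phi> (fst e))" if "e \<in> set p" for e
    using that[THEN subsetD[OF arcs]] assms d
    by (cases e rule: arc_cases) (auto simp: \<phi>_def split: if_splits)
  then show ?thesis
    unfolding transfers_into_def last_transfers_def
    using sum_closed_walk[OF closed dist, of \<phi>] by (simp add: sum.distrib)
qed

text \<open>
  The cut \<open>\<psi> \<le> q - 1 - a t\<close> of block \<open>t\<close> contains all entries into the block, and the only vertex
  by which it can be left is the last one.
\<close>

lemma transfers_into_add_wraps_le_1:
  assumes "t < d"
  shows "transfers_into t + wraps t \<le> 1"
proof -
  define \<phi> where "\<phi> v = (of_bool (fst v = t \<and> \<psi> v \<le> int q - 1 - int (a t)) :: int)" for v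
  \<comment> \<open>The last vertex of the cut, found by solving
    \<open>\<psi> (t, i) = q - 1 - a t\<close>.\<close>
  define i where "i = (X - N t - int t - int (a t)) mod int q"
  have i: "i \<in> {0..<int q}" 
    using q by (simp add: i_def)
  have "\<psi> (t, i) = (- 1 - int (a t)) mod int q"
    using mod_add_left_eq[of "X - N t - int t - int (a t)" "int q" "int t - (X + 1 - N t)"]
    by (simp add: \<psi>_def i_def algebra_simps)
  also have "\<dots> = int q - 1 - int (a t)"
    using a_le[OF assms] by (intro mod_unique) (auto simp: cong_iff_dvd_diff)
  finally have \<psi>_i: "\<psi> (t, i) = int q - 1 - int (a t)" .
  \<comment> \<open>Entries raise \<open>\<phi>\<close>, and only an arc with tail
    \<open>(t, i)\<close> can lower it. A wrap raises \<open>\<phi>\<close> too, unless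
    \<open>a t = 0\<close>; then the cut is the whole block and the wrap itself has tail
    \<open>(t, i)\<close>.\<close>
  have "of_bool (fst (fst e) \<noteq> t \<and> fst (snd e) = t) 
      + of_bool (fst (fst e) = t \<and> fst (snd e) = t \<and> \<psi> (fst e) = int q - 1)
    \<le> of_bool (fst e = (t, i)) + (\<phi> (snd e) - \<phi> (fst e))" if "e \<in> set p" for e
    using that[THEN subsetD[OF arcs]]
  proof (cases e rule: arc_cases)
    case (step t' i' j)
    have "i' = i" if "t' = t" "\<psi> (t', i') = int q - 1 - int (a t)"
      using that \<psi>_i step(5) i \<psi>_inj[of t i' i] by simp
    then show ?thesis
      using step(2-4)
      by (cases "t' = t"; cases "\<psi> (t, i') = int q - 1 - int (a t)") (auto simp: \<phi>_def; linarith)+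
  next
    case (wrap t' i' j)
    have "i' = i" if "t' = t" "a t = 0"
      using that \<psi>_i wrap(3,5) i \<psi>_inj[of t i' i] by simp
    then show ?thesis
      using wrap(2-4) a_le[OF assms] by (cases "t' = t") (auto simp: \<phi>_def)
  next
    case (transfer t1 t2 i' j g)
    have "i' = i" if "t1 = t" "g \<ge> int (a t)"
      using that \<psi>_i transfer(5,6,8) i \<psi>_inj[of t i' i] by simp
    moreover have "t1 \<noteq> t2"
      using transfer(1,2) d by auto
    moreover have "\<psi> (t2, j) \<le> int q - 1 - int (a t)" if "t2 = t"
      using a_add_le[OF \<open>t1 < d\<close> assms] \<open>t1 \<noteq> t2\<close> that transfer(4,7) by simp
    ultimately show ?thesis
      using transfer(3-6) by (cases "t1 = t"; cases "t2 = t") (auto simp: \<phi>_def)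
  qed
  then have "transfers_into t + wraps t 
    \<le> (\<Sum>e\<in>set p. of_bool (fst e = (t, i)) + (\<phi> (snd e) - \<phi> (fst e)))"
    unfolding transfers_into_def wraps_def sum.distrib[symmetric] by (rule sum_mono)
  also have "\<dots> \<le> 1"
    using sum_closed_walk[OF closed dist, of \<phi>] sum_tail_le_1[OF dist] by (simp add: sum.distrib)
  finally show ?thesis .
qed

lemma length_eq:
  "int (length p) = (int (q * d) - int z) * last_transfers + int q * (\<Sum>t<d. wraps t)"
proof -
  \<comment> \<open>\<open>\<phi>\<close> grows by \<open>1\<close> along every arc, except that a wrap loses \<open>q\<close> and a last transfer loses \<open>q d - z\<close>.\<close>
  define \<phi> where "\<phi> v = \<psi> v - N (fst v) + int q * int (fst v)" for v
  have N_end: "N (d - 1) + int (a (d - 1)) = int z" and N_0: "N 0 = 0"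
    using N_Suc[of "d - 1"] N_d d by (simp_all add: N_def)
  have "1 = (int (q * d) - int z) * of_bool (fst (fst e) = d - 1 \<and> fst (snd e) = 0)
      + int q * (\<Sum>t<d. of_bool (fst (fst e) = t \<and> fst (snd e) = t \<and> \<psi> (fst e) = int q - 1))
      + (\<phi> (snd e) - \<phi> (fst e))" if "e \<in> set p" for e
  proof -
    have "(\<Sum>t<d. of_bool (fst (fst e) = t \<and> fst (snd e) = t \<and> \<psi> (fst e) = int q - 1)) =
      (\<Sum>t<d. if t = fst (fst e) then of_bool (fst (snd e) = t \<and> \<psi> (fst e) = int q - 1) else (0::int))"
      by (intro sum.cong) auto
    also have "\<dots> = of_bool (fst (snd e) = fst (fst e) \<and> \<psi> (fst e) = int q - 1)" if "fst (fst e) < d"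
      using that by simp
    finally have wrap_sum: "(\<Sum>t<d. of_bool (fst (fst e) = t \<and> fst (snd e) = t \<and> \<psi> (fst e) = int q - 1))
      = (of_bool (fst (snd e) = fst (fst e) \<and> \<psi> (fst e) = int q - 1) :: int)" if "fst (fst e) < d"
      using that by simp
    show ?thesis
      using that[THEN subsetD[OF arcs]]
    proof (cases e rule: arc_cases)
      case (transfer t t' i j g)
      then show ?thesis
        using wrap_sum d N_end by (cases "t = d - 1") (auto simp: \<phi>_def N_Suc N_0 algebra_simps of_nat_diff)
    qed (use wrap_sum d in \<open>auto simp: \<phi>_def\<close>)
  qed
  then have "(\<Sum>e\<in>set p. 1) = (\<Sum>e\<in>set p. (int (q * d) - int z) * of_bool (fst (fst e) = d - 1 \<and> fst (snd e) = 0)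
      + int q * (\<Sum>t<d. of_bool (fst (fst e) = t \<and> fst (snd e) = t \<and> \<psi> (fst e) = int q - 1))
      + (\<phi> (snd e) - \<phi> (fst e)))"
    by (intro sum.cong) auto
  moreover have "(\<Sum>e\<in>set p. 1) = int (length p)"
    using distinct_card[of p] dist by (simp add: distinct_map)
  ultimately show ?thesis
    using sum_closed_walk[OF closed dist, of \<phi>]
    unfolding last_transfers_def wraps_def sum.swap[of _ "set p"] 
    by (simp only: sum.distrib sum_distrib_left)
qed

text \<open>If there is a round at all, the cut bound leaves exactly one and no wraps, and
  \<open>length_eq\<close> gives the length. Without rounds no block is ever entered from another,
  so the walk stays in one block, and conservation at each vertex forces it all the way
  around.\<close>

lemma closed_walk_cases: "length p = q * d - z \<or> (\<exists>t<d. set p = horizontal_arcs q t)"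
proof (cases "last_transfers = 0")
  case False
  have nonneg: "0 \<le> transfers_into t" "0 \<le> wraps t" for t
    by (auto simp: transfers_into_def wraps_def intro: sum_nonneg)
  have *: "last_transfers = 1" "wraps t = 0" if "t < d" for t
    using transfers_into_add_wraps_le_1[OF that] transfers_into_eq[OF that] nonneg[of t] False by auto
  then have "int (length p) = int (q * d) - int z"
    using length_eq d *(1)[of 0] by simp
  moreover have "z \<le> q * d"
    using z d q by (metis dual_order.trans less_imp_le mult_le_mono2 nat_mult_1_right one_le_numeral)
  ultimately show ?thesis
    by linarith
next
  case True
  have horiz: "fst (snd e) = fst (fst e)" if "e \<in> set p" for e
  proof (rule ccontr)
    assume ne: "fst (snd e) \<noteq> fst (fst e)"
    define t where "t = fst (snd e)"
    have "t < d" 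
      using that[THEN subsetD[OF arcs]] d 
      by (cases e rule: arc_cases) (auto simp: t_def)
    then have "transfers_into t = 0"
      using transfers_into_eq True by simp
    then have "of_bool (fst (fst e) \<noteq> t \<and> fst (snd e) = t) = (0::int)"
      unfolding transfers_into_def using that by (subst (asm) sum_nonneg_eq_0_iff) auto
    then show False
      using ne by (auto simp: t_def)
  qed
  define t where "t = fst u"
  have fst_t: "fst (fst e) = t" if "e \<in> set p" for e
    using pcas_map_fst[OF closed horiz that] by (simp add: t_def)
  have sub_hor: "set p \<subseteq> horizontal_arcs q t"
  proof
    fix e assume "e \<in> set p"
    then show "e \<in> horizontal_arcs q t"
      using fst_t[of e] horiz[of e] arcs d
      by (cases e rule: arc_cases[OF subsetD[OF arcs]]) (auto simp: horizontal_arcs_def split: if_splits)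
  qed
  have succ: "((t, (i + 1) mod int q), (t, ((i + 1) mod int q + 1) mod int q)) \<in> set p" 
    if "((t, i), (t, (i + 1) mod int q)) \<in> set p" for i
  proof (rule ccontr)
    assume notin: "\<not> ?thesis"
    \<comment> \<open>Flow balance at a single vertex: it is entered, so it must also be
      left.\<close>
    define \<phi> where "\<phi> v = (of_bool (v = (t, (i + 1) mod int q)) :: int)" for v
    have "fst e \<noteq> (t, (i + 1) mod int q)" if "e \<in> set p" for e
      using that notin sub_hor by (auto simp: horizontal_arcs_def)
    then have "(\<Sum>e\<in>set p. \<phi> (snd e) - \<phi> (fst e)) = (\<Sum>e\<in>set p. \<phi> (snd e))"
      by (intro sum.cong) (auto simp: \<phi>_def)
    then have "(\<Sum>e\<in>set p. \<phi> (snd e)) = 0"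
      using sum_closed_walk[OF closed dist, of \<phi>] by simp
    then have "\<forall>e\<in>set p. \<phi> (snd e) = 0"
      by (subst (asm) sum_nonneg_eq_0_iff) (auto simp: \<phi>_def)
    then show False
      using that by (auto simp: \<phi>_def)
  qed
  obtain e where "e \<in> set p"
    using nonempty by (cases p) auto
  then obtain i where i: "((t, i), (t, (i + 1) mod int q)) \<in> set p" "i \<in> {0..<int q}"
    using sub_hor by (auto simp: horizontal_arcs_def)
  have all: "((t, (i + int k) mod int q), (t, ((i + int k) mod int q + 1) mod int q)) \<in> set p" for k
  proof (induction k)
    case 0
    then show ?case using i by simp
  next
    case (Suc k)
    then show ?case
      using succ[of "(i + int k) mod int q"] by (simp add: mod_simps add_ac)
  qed
  have "horizontal_arcs q t \<subseteq> set p"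
  proof
    fix e assume "e \<in> horizontal_arcs q t"
    then obtain j where j: "e = ((t, j), (t, (j + 1) mod int q))" "j \<in> {0..<int q}"
      by (auto simp: horizontal_arcs_def)
    have "(i + int (nat ((j - i) mod int q))) mod int q = j"
      using j(2) q by (simp add: mod_simps)
    then show "e \<in> set p"
      using all[of "nat ((j - i) mod int q)"] j(1) by simp
  qed
  moreover have "t < d"
    using i(1) arcs parcs_iff by blast
  ultimately show ?thesis
    using sub_hor by blast
qed

end

lemma admissible: "typeII_admissible q d z S"
  unfolding typeII_admissible_def cycle_with_proj_iff
  using closed_walk_cases ne sub by blast

end

section \<open>Tours through the blocks\<close>

lemma pcas_append: "pcas u (p @ r) v \<longleftrightarrow> (\<exists>w. pcas u p w \<and> pcas w r v)"
  by (induction p arbitrary: u) auto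

lemma distinct_concat_map_upt:
  assumes "\<And>k. k < n \<Longrightarrow> distinct (f k)"
    and "\<And>k k'. k < k' \<Longrightarrow> k' < n \<Longrightarrow> set (f k) \<inter> set (f k') = {}"
  shows "distinct (concat (map f [0..<n]))"
  using assms by (induction n) fastforce+

definition block_walk :: "nat \<Rightarrow> nat \<Rightarrow> int \<Rightarrow> nat \<Rightarrow> ((nat \<times> int) \<times> (nat \<times> int)) list" where
  "block_walk q t e h =
    map (\<lambda>j. ((t, (e + int j) mod int q), (t, (e + int j + 1) mod int q))) [0..<h]"

text \<open>
  The \<open>k\<close>-th visit enters block \<open>b k\<close> at \<open>en k\<close> and makes \<open>h k\<close> horizontal steps.
\<close>

definition tour ::
  "nat \<Rightarrow> (nat \<Rightarrow> nat) \<Rightarrow> (nat \<Rightarrow> int) \<Rightarrow> (nat \<Rightarrow> nat) \<Rightarrow> nat \<Rightarrow> ((nat \<times> int) \<times> (nat \<times> int)) list" where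
  "tour q b en h n = concat (map (\<lambda>k. block_walk q (b k) (en k) (h k) @
    [((b k, (en k + int (h k)) mod int q), (b (Suc k), en (Suc k) mod int q))]) [0..<n])"

lemma pcas_block_walk: "pcas (t, e mod int q) (block_walk q t e h) (t, (e + int h) mod int q)"
  by (induction h) (auto simp: block_walk_def pcas_append add_ac)

lemma pcas_tour: "pcas (b 0, en 0 mod int q) (tour q b en h n) (b n, en n mod int q)"
proof (induction n)
  case (Suc n)
  then show ?case
    using pcas_block_walk[of "b n" "en n" q "h n"] by (auto simp: tour_def pcas_append)
qed (simp add: tour_def)

lemma map_fst_tour:
  "map fst (tour q b en h n) =
    concat (map (\<lambda>k. map (\<lambda>j. (b k, (en k + int j) mod int q)) [0..<Suc (h k)]) [0..<n])"
  by (simp add: tour_def block_walk_def map_concat comp_def)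

lemma length_tour: "length (tour q b en h n) = (\<Sum>k<n. h k + 1)"
  by (induction n) (simp_all add: tour_def block_walk_def)

context typeII
begin

text \<open>A repeated tail would occur either within one visit, which \<open>h k < q\<close>
  excludes, or in two visits to the same block, which \<open>disj\<close> excludes.\<close>

lemma cycle_tour:
  assumes "0 < n"
    and b: "\<And>k. k < n \<Longrightarrow> b k < d"
    and h: "\<And>k. k < n \<Longrightarrow> h k < q"
    and transfer: "\<And>k. k < n \<Longrightarrow>
      ((b k, (en k + int (h k)) mod int q), (b (Suc k), en (Suc k) mod int q)) \<in> parcs G"
    and closed: "b n = b 0" "en n mod int q = en 0 mod int q"
    and disj: "\<And>k k' j j'. k < k' \<Longrightarrow> k' < n \<Longrightarrow> b k = b k' \<Longrightarrow> j \<le> h k \<Longrightarrow> j' \<le> h k' \<Longrightarrow>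
      (en k + int j) mod int q \<noteq> (en k' + int j') mod int q"
  shows "pre_digraph.cycle (with_proj G) (tour q b en h n)"
  unfolding cycle_with_proj_iff
proof (intro exI conjI)
  show "(b 0, en 0 mod int q) \<in> pverts G"
    using b[OF assms(1)] q by (simp add: typeII_digraph_def)
  show "pcas (b 0, en 0 mod int q) (tour q b en h n) (b 0, en 0 mod int q)"
    using pcas_tour[of b en q h n] closed by simp
  show "tour q b en h n \<noteq> []"
    using length_tour[of q b en h n] assms(1) by (auto simp: sum_nonneg_eq_0_iff)
  have walk: "set (block_walk q (b k) (en k) (h k)) \<subseteq> parcs G" if "k < n" for k
    using b[OF that] q by (auto simp: block_walk_def parcs_iff mod_simps)
  show "set (tour q b en h n) \<subseteq> parcs G"
    using transfer by (auto simp: tour_def dest: subsetD[OF walk])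
  have "inj_on (\<lambda>j. (b k, (en k + int j) mod int q)) {0..<Suc (h k)}" if "k < n" for k
  proof (rule inj_onI)
    fix j j' assume j: "j \<in> {0..<Suc (h k)}" "j' \<in> {0..<Suc (h k)}"
      and "(b k, (en k + int j) mod int q) = (b k, (en k + int j') mod int q)"
    then have "[int j = int j'] (mod int q)"
      using cong_add_lcancel[of "en k"] by (simp add: cong_def)
    then show "j = j'"
      using j h[OF that] by (simp add: cong_def)
  qed
  moreover have "set (map (\<lambda>j. (b k, (en k + int j) mod int q)) [0..<Suc (h k)]) \<inter>
      set (map (\<lambda>j. (b k', (en k' + int j) mod int q)) [0..<Suc (h k')]) = {}"
    if "k < k'" "k' < n" for k k'
    using disj[OF that] by (auto simp del: upt_Suc)
  ultimately show "distinct (map fst (tour q b en h n))"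
    unfolding map_fst_tour by (intro distinct_concat_map_upt) (auto simp: distinct_map simp del: upt_Suc)
qed

end

section \<open>Admissible families are separated\<close>

locale admissible = typeII +
  assumes adm: "typeII_admissible q d z S"
begin

text \<open>The first transfer changes the block, so the tour is not a horizontal cycle and
  admissibility dictates its length.\<close>

lemma length_cycle_tour:
  assumes "0 < n"
    and b: "\<And>k. k < n \<Longrightarrow> b k < d"
    and h: "\<And>k. k < n \<Longrightarrow> h k < q"
    and transfer: "\<And>k. k < n \<Longrightarrow>
      ((b k, (en k + int (h k)) mod int q), (b (Suc k), en (Suc k) mod int q)) \<in> parcs G"
    and closed: "b n = b 0" "en n mod int q = en 0 mod int q"
    and disj: "\<And>k k' j j'. k < k' \<Longrightarrow> k' < n \<Longrightarrow> b k = b k' \<Longrightarrow> j \<le> h k \<Longrightarrow> j' \<le> h k' \<Longrightarrow>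
      (en k + int j) mod int q \<noteq> (en k' + int j') mod int q"
    and "b 1 \<noteq> b 0"
  shows "(\<Sum>k<n. int (h k) + 1) = int (q * d) - int z"
proof -
  have "((b 0, (en 0 + int (h 0)) mod int q), (b 1, en 1 mod int q)) \<in> set (tour q b en h n)"
    using assms(1) by (force simp: tour_def)
  then have "set (tour q b en h n) \<noteq> horizontal_arcs q t" for t
    using \<open>b 1 \<noteq> b 0\<close> by (auto simp: horizontal_arcs_def)
  then have "length (tour q b en h n) = q * d - z"
    using adm cycle_tour[OF assms(1-7)] unfolding typeII_admissible_def by blast
  moreover have "z \<le> q * d"
    using z d q by (metis dual_order.trans less_imp_le mult_le_mono2 nat_mult_1_right one_le_numeral)
  ultimately have "int (\<Sum>k<n. h k + 1) = int (q * d) - int z"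
    by (simp only: length_tour of_nat_diff)
  then show ?thesis
    by (simp only: of_nat_sum of_nat_add of_nat_1)
qed

section \<open>Downward cyclic distances between exits\<close>

definition \<delta> :: "int \<Rightarrow> int \<Rightarrow> int" where
  "\<delta> x y = (x - y) mod int q"

text \<open>In the coordinate \<open>i + t\<close> all arcs except the last transfers advance by \<open>1\<close>.\<close>

definition U :: "nat \<Rightarrow> int set" where
  "U t = (\<lambda>i. i + int t) ` S t"

lemma \<delta>_bounds: "0 \<le> \<delta> x y" "\<delta> x y < int q"
  using q by (auto simp: \<delta>_def)

lemma \<delta>_unique:
  assumes "[x - y = r] (mod int q)" "0 \<le> r" "r < int q"
  shows "\<delta> x y = r"
  using assms by (simp add: \<delta>_def cong_def)

text \<open>The exits \<open>s\<close> determine a cycle with one round. Its visit to a block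
  \<open>k \<ge> 1\<close>, with the transfer out of it, has \<open>q\<close> arcs minus the
  distance from the previous exit; the visit to block 0 has at most \<open>q\<close>. Comparing with
  the length \<open>q * d - z\<close> bounds the distances.\<close>

lemma one_round:
  assumes s: "\<And>t. t < d \<Longrightarrow> s t \<in> S t"
  shows "(\<Sum>k\<in>{1..<d}. \<delta> (s (k - 1) + int (k - 1)) (s k + int k)) \<le> int z"
proof -
  \<comment> \<open>A block is entered where the previous one was left; only the last transfer
    shifts by \<open>d + z\<close>. The value at \<open>d\<close> closes the tour.\<close>
  define en where "en k = (if k = 0 \<or> k = d then s (d - 1) + int (d + z) else s (k - 1))" for k
  define h where "h k = nat ((s k - en k) mod int q)" for k
  have h: "int (h k) = (s k - en k) mod int q" for k
    using q by (simp add: h_def)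
  have h_less: "h k < q" for k
    using q by (simp add: h_def nat_less_iff)
  have exit: "(en k + int (h k)) mod int q = s k" if "k < d" for k
    using sub[OF that] s[OF that] by (auto simp: h mod_simps)
  have "(\<Sum>k<d. int (h k) + 1) = int (q * d) - int z"
  proof (rule length_cycle_tour[where b = "\<lambda>k. k mod d" and en = en])
    fix k assume "k < d"
    show "h k < q"
      by (rule h_less)
    show "((k mod d, (en k + int (h k)) mod int q), Suc k mod d, en (Suc k) mod int q) \<in> parcs G"
    proof (cases "Suc k = d")
      case True
      then show ?thesis
        using exit[OF \<open>k < d\<close>] s[OF \<open>k < d\<close>] \<open>k < d\<close> by (auto simp: parcs_iff en_def)
    next
      case False
      then show ?thesis
        using exit[OF \<open>k < d\<close>] s[OF \<open>k < d\<close>] \<open>k < d\<close> sub[OF \<open>k < d\<close>] by (auto simp: parcs_iff en_def)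
    qed
  qed (use d in \<open>auto simp: en_def\<close>)
  moreover have "(\<Sum>k<d. int (h k) + 1) = int (h 0) + 1 + (\<Sum>k\<in>{1..<d}. int (h k) + 1)"
    using d by (simp add: lessThan_atLeast0 sum.atLeast_Suc_lessThan)
  moreover have "(\<Sum>k\<in>{1..<d}. int (h k) + 1) =
    (\<Sum>k\<in>{1..<d}. int q - \<delta> (s (k - 1) + int (k - 1)) (s k + int k))"
  proof (rule sum.cong)
    fix k assume k: "k \<in> {1..<d}"
    then have "s (k - 1) + int (k - 1) - (s k + int k) = - 1 - (s k - en k)"
      by (auto simp: en_def of_nat_diff)
    then have "[s (k - 1) + int (k - 1) - (s k + int k) = - 1 - (s k - en k)] (mod int q)"
      by (simp only: cong_refl)
    also have "[- 1 - (s k - en k) = - 1 - int (h k)] (mod int q)"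
      unfolding h by (intro cong_diff cong_refl) (simp add: cong_def)
    also have "[- 1 - int (h k) = int q - 1 - int (h k)] (mod int q)"
      by (simp add: cong_iff_dvd_diff)
    finally have "\<delta> (s (k - 1) + int (k - 1)) (s k + int k) = int q - 1 - int (h k)"
      by (rule \<delta>_unique) (use h_less[of k] in auto)
    then show "int (h k) + 1 = int q - \<delta> (s (k - 1) + int (k - 1)) (s k + int k)"
      by simp
  qed simp
  ultimately show ?thesis
    using d h_less[of 0] by (simp add: sum_subtractf of_nat_diff algebra_simps)
qed

text \<open>The sum telescopes modulo \<open>q\<close>. As part of the sum in
  \<open>one_round\<close> it lies between \<open>0\<close> and \<open>z < q\<close>, so the
  congruence becomes an equality.\<close>

lemma sum_\<delta>:
  assumes s: "\<And>t. t < d \<Longrightarrow> s t \<in> S t" and "i \<le> j" "j < d"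
  shows "(\<Sum>k\<in>{i<..j}. \<delta> (s (k - 1) + int (k - 1)) (s k + int k)) = \<delta> (s i + int i) (s j + int j)"
    and "\<delta> (s i + int i) (s j + int j) \<le> int z"
proof -
  have *: "[s i + int i - (s j + int j) =
    (\<Sum>k\<in>{i<..j}. \<delta> (s (k - 1) + int (k - 1)) (s k + int k))] (mod int q)"
    using assms(2)
  proof (induction j rule: dec_induct)
    case (step j)
    have "{i<..Suc j} = insert (Suc j) {i<..j}"
      using step by auto
    then have sum_Suc: "(\<Sum>k\<in>{i<..Suc j}. \<delta> (s (k - 1) + int (k - 1)) (s k + int k)) =
      (\<Sum>k\<in>{i<..j}. \<delta> (s (k - 1) + int (k - 1)) (s k + int k)) +
      \<delta> (s j + int j) (s (Suc j) + int (Suc j))"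
      by simp
    have "s i + int i - (s (Suc j) + int (Suc j)) =
      (s i + int i - (s j + int j)) + (s j + int j - (s (Suc j) + int (Suc j)))"
      by simp
    moreover have "[s j + int j - (s (Suc j) + int (Suc j)) =
      \<delta> (s j + int j) (s (Suc j) + int (Suc j))] (mod int q)"
      by (simp add: \<delta>_def cong_def)
    ultimately show ?case
      unfolding sum_Suc by (simp only: cong_add[OF step.IH])
  qed simp
  have le: "(\<Sum>k\<in>{i<..j}. \<delta> (s (k - 1) + int (k - 1)) (s k + int k)) \<le> int z"
    using one_round[OF s] assms(3) \<delta>_bounds
    by (intro order.trans[OF sum_mono2 one_round[OF s]]) auto
  show "(\<Sum>k\<in>{i<..j}. \<delta> (s (k - 1) + int (k - 1)) (s k + int k)) = \<delta> (s i + int i) (s j + int j)"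
    using \<delta>_unique[OF *] le \<delta>_bounds z by (simp add: sum_nonneg)
  then show "\<delta> (s i + int i) (s j + int j) \<le> int z"
    using le by simp
qed

lemma exists_selection:
  obtains s where "\<forall>t<d. s t \<in> S t"
  using that[of "\<lambda>t. SOME i. i \<in> S t"] ne by (simp add: some_in_eq)

lemma \<delta>_le:
  assumes "x \<in> U i" "y \<in> U j" "i < j" "j < d"
  shows "\<delta> x y \<le> int z"
proof -
  obtain s0 where "\<forall>t<d. s0 t \<in> S t"
    by (rule exists_selection)
  define s where "s = s0(i := x - int i, j := y - int j)"
  have s: "s t \<in> S t" if "t < d" for t
    using that assms \<open>\<forall>t<d. s0 t \<in> S t\<close> by (auto simp: s_def U_def)
  have "x = s i + int i" "y = s j + int j"
    using assms(3) by (auto simp: s_def)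
  then show ?thesis
    using sum_\<delta>(2)[OF s, of i j] assms(3,4) by simp
qed

text \<open>A single selection can contain all three given exits, and its sum from \<open>i\<close>
  to \<open>k\<close> splits at \<open>j\<close>.\<close>

lemma \<delta>_add:
  assumes "x \<in> U i" "y \<in> U j" "w \<in> U k" "i < j" "j < k" "k < d"
  shows "\<delta> x w = \<delta> x y + \<delta> y w"
proof -
  obtain s0 where "\<forall>t<d. s0 t \<in> S t"
    by (rule exists_selection)
  define s where "s = s0(i := x - int i, j := y - int j, k := w - int k)"
  have s: "s t \<in> S t" if "t < d" for t
    using that assms \<open>\<forall>t<d. s0 t \<in> S t\<close> by (auto simp: s_def U_def)
  have xyw: "x = s i + int i" "y = s j + int j" "w = s k + int k"
    using assms(4,5) by (auto simp: s_def)
  have "{i<..k} = {i<..j} \<union> {j<..k}"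
    using assms by auto
  then have "(\<Sum>l\<in>{i<..k}. \<delta> (s (l - 1) + int (l - 1)) (s l + int l)) =
    (\<Sum>l\<in>{i<..j}. \<delta> (s (l - 1) + int (l - 1)) (s l + int l)) +
    (\<Sum>l\<in>{j<..k}. \<delta> (s (l - 1) + int (l - 1)) (s l + int l))"
    by (simp add: sum.union_disjoint disjoint_iff)
  then show ?thesis
    using sum_\<delta>(1)[OF s, of i k] sum_\<delta>(1)[OF s, of i j] sum_\<delta>(1)[OF s, of j k] assms xyw
    by simp
qed

text \<open>
  For \<open>d = 2\<close> the cycles with one round do not exclude that \<open>S 0\<close> and \<open>S 1\<close> interleave, but then
  there is a cycle with two rounds, of length \<open>3 q - 2 z\<close>.
\<close>

lemma not_interleaved:
  assumes d2: "d = 2" and order: "W \<le> Y" "Y < V" "V \<le> X" "X \<le> W + int z" "Y + int q \<le> V + int z"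
    and S: "X mod int q \<in> S 0" "Y mod int q \<in> S 0" "(V - 1) mod int q \<in> S 1" "(W - 1) mod int q \<in> S 1"
  shows False
proof -
  \<comment> \<open>Block 0 is left at \<open>Y\<close>, then at \<open>X\<close>; block 1 at
    \<open>V - 1\<close>, then at \<open>W - 1\<close>. The last transfer adds
    \<open>d + z = 2 + z\<close>, which gives the entries into block 0.\<close>
  define en where "en = (\<lambda>k::nat. if k = 0 then W + 1 + int z else if k = 1 then Y
    else if k = 2 then V + 1 + int z else if k = 3 then X else W + 1 + int z)"
  define h where "h = (\<lambda>k::nat. if k = 0 then nat (Y + int q - (W + 1 + int z)) else if k = 1 then nat (V - 1 - Y)
    else if k = 2 then nat (X + int q - (V + 1 + int z)) else nat (W - 1 + int q - X))"
  have four: "k = 0 \<or> k = 1 \<or> k = 2 \<or> k = 3" if "k < 4" for k :: nat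
    using that by auto
  have disj: "x mod int q \<noteq> y mod int q" if "x < y" "y < x + int q" for x y
  proof
    assume "x mod int q = y mod int q"
    then have "int q dvd y - x"
      by (metis mod_eq_dvd_iff)
    then show False
      using that zdvd_not_zless[of "y - x" "int q"] by simp
  qed
  have ends: "en 0 + int (h 0) = Y + int q" "en 1 + int (h 1) = V - 1"
    "en 2 + int (h 2) = X + int q" "en 3 + int (h 3) = W - 1 + int q"
    using order z by (simp_all add: en_def h_def)
  have down: "((0, i mod int q), (1, i mod int q)) \<in> parcs G" if "i mod int q \<in> S 0" for i
    unfolding parcs_iff using that d2 by simp
  have up: "((1, (i - 1) mod int q), (0, (i + 1 + int z) mod int q)) \<in> parcs G"
    if "(i - 1) mod int q \<in> S 1" for i
    unfolding parcs_iff using that d2 mod_add_left_eq[of "i - 1" "int q" "2 + int z"]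
    by (simp add: algebra_simps)
  have "(\<Sum>k<4. int (h k) + 1) = int (q * d) - int z"
  proof (rule length_cycle_tour[where b = "\<lambda>k. k mod 2" and en = en])
    fix k :: nat assume "k < 4"
    from four[OF this] show "h k < q"
      using order z by (auto simp: h_def nat_less_iff)
    from four[OF \<open>k < 4\<close>] 
    show "((k mod 2, (en k + int (h k)) mod int q), Suc k mod 2, en (Suc k) mod int q) \<in> parcs G"
      using down[OF S(1)] down[OF S(2)] up[OF S(3)] up[OF S(4)]
      by (elim disjE) (simp_all add: ends ends(2)[unfolded One_nat_def], simp_all add: en_def)
  next
    fix k k' j j' :: nat
    assume kk: "k < k'" "k' < 4" "k mod 2 = k' mod 2" and j: "j \<le> h k" "j' \<le> h k'"
    then have "k = 0 \<and> k' = 2 \<or> k = 1 \<and> k' = 3"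
      using four[of k] four[of k'] by auto
    \<comment> \<open>The visits to block 0 are disjoint by \<open>Y + q \<le> V + z\<close> and
      \<open>X \<le> W + z\<close>, those to block 1 by \<open>V \<le> X\<close> and
      \<open>W \<le> Y\<close>.\<close>
    then show "(en k + int j) mod int q \<noteq> (en k' + int j') mod int q"
      using j order z by (intro disj) (auto simp: en_def h_def)
  qed (auto simp: d2 en_def)
  \<comment> \<open>Equating \<open>3 * q - 2 * z\<close> with the prescribed
    \<open>2 * q - z\<close> would give \<open>q = z\<close>.\<close>
  then show False
    using order z d2 by (simp add: h_def eval_nat_numeral)
qed

text \<open>Each exit gets a depth \<open>f\<close> below a top element \<open>X\<close>. No depth
  in a block exceeds a depth in a later one, so the maximal depths of the blocks can serve as the
  dividing points of the window.\<close>

lemma exists_intervals: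
  obtains a :: "nat \<Rightarrow> nat" and X :: int where "(\<Sum>t<d. a t) = z"
    "\<And>t. t < d \<Longrightarrow> S t \<subseteq> cyc_interval q (X - int t - (\<Sum>j<Suc t. int (a j))) (X - int t - (\<Sum>j<t. int (a j)))"
proof -
  have U_ne: "U t \<noteq> {}" and U_fin: "finite (U t)" if "t < d" for t
    using ne[OF that] finite_subset[OF sub[OF that]] by (auto simp: U_def)
  obtain w where w: "w \<in> U (d - 1)"
    using U_ne[of "d - 1"] d by auto
  obtain X where X: "X \<in> U 0" and X_max: "\<And>x. x \<in> U 0 \<Longrightarrow> \<delta> x w \<le> \<delta> X w"
  proof -
    have "Max ((\<lambda>x. \<delta> x w) ` U 0) \<in> (\<lambda>x. \<delta> x w) ` U 0"
      using U_ne[of 0] U_fin[of 0] d by (intro Max_in) auto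
    then obtain X where "X \<in> U 0" "\<delta> X w = Max ((\<lambda>x. \<delta> x w) ` U 0)"
      by auto
    then show ?thesis
      using that[of X] U_fin[of 0] d by simp
  qed
  \<comment> \<open>The bound \<open>\<delta>_le\<close> needs two different blocks, so depths
    inside block 0 are measured through the reference point \<open>w\<close> in the last
    block.\<close>
  define f where "f t y = (if t = 0 then \<delta> X w - \<delta> y w else \<delta> X y)" for t :: nat and y
  have f_cong: "[y = X - f t y] (mod int q)" for t y
  proof (cases "t = 0")
    case True
    have "[y - w = \<delta> y w] (mod int q)" "[X - w = \<delta> X w] (mod int q)"
      by (auto simp: \<delta>_def cong_def)
    then have "[(y - w) - (X - w) + X = \<delta> y w - \<delta> X w + X] (mod int q)"
      by (intro cong_diff cong_add cong_refl)
    then show ?thesis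
      using True by (simp add: f_def algebra_simps)
  next
    case False
    have "[X - (X - y) = X - \<delta> X y] (mod int q)"
      by (intro cong_diff cong_refl) (auto simp: \<delta>_def cong_def)
    then show ?thesis
      using False by (simp add: f_def)
  qed
  have f_nonneg: "0 \<le> f t y" if "y \<in> U t" for t y
    using that X_max \<delta>_bounds by (auto simp: f_def)
  have f_le: "f t y \<le> int z" if "t < d" "y \<in> U t" for t y
    using that \<delta>_le[OF X w] \<delta>_le[OF X, of y t] d \<delta>_bounds[of y w] by (auto simp: f_def)
  have f_mono: "f i x \<le> f j y" if "i < j" "j < d" "x \<in> U i" "y \<in> U j" for i j x y
  proof -
    \<comment> \<open>Additivity through \<open>y\<close> on the way to \<open>w\<close> turns
      \<open>f 0 x\<close> into \<open>\<delta> X y - \<delta> x y\<close>.\<close>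
    have middle: "f 0 x \<le> f j y" if "0 < j" "j < d - 1" "x \<in> U 0" "y \<in> U j" for j x y
      using \<delta>_add[OF X that(4) w that(1,2)] \<delta>_add[OF that(3,4) w that(1,2)] d \<delta>_bounds[of x y] that
      by (auto simp: f_def)
    consider "0 < i" | "i = 0" "j < d - 1" | "i = 0" "j = d - 1" "d \<ge> 3" | "i = 0" "j = 1" "d = 2"
    proof -
      have "j = d - 1" if "\<not> j < d - 1"
        using that \<open>j < d\<close> by linarith
      moreover have "j = 1 \<and> d = 2" if "\<not> j < d - 1" "\<not> d \<ge> 3"
        using that \<open>j < d\<close> d by linarith
      ultimately show thesis
        using that by blast
    qed
    then show ?thesis
    proof cases
      case 1
      then show ?thesis
        using \<delta>_add[OF X that(3,4)] that \<delta>_bounds[of x y] by (auto simp: f_def)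
    next
      case 2
      then show ?thesis
        using middle that by auto
    next
      case 3
      \<comment> \<open>Here \<open>y\<close> lies in the block of \<open>w\<close>, so it is not
        between \<open>x\<close> and \<open>w\<close>; an element of block 1 mediates
        instead.\<close>
      obtain v where v: "v \<in> U 1"
        using U_ne[of 1] d by auto
      have "f 0 x \<le> f 1 v"
        using middle[of 1 x v] 3 that v by auto
      also have "f 1 v \<le> f j y"
        using \<delta>_add[OF X v that(4)] 3 \<delta>_bounds[of v y] by (auto simp: f_def)
      finally show ?thesis
        using 3 by simp
    next
      case 4
      show ?thesis
      proof (rule ccontr)
        assume "\<not> f i x \<le> f j y"
        then have less: "\<delta> X y < \<delta> X w - \<delta> x w"
          using 4 by (simp add: f_def)
        have mod_U: "i mod int q \<in> S t" if "[j = i + int t] (mod int q)" "j \<in> U t" "t < d" for i j t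
        proof -
          obtain k where k: "k \<in> S t" "j = k + int t"
            using \<open>j \<in> U t\<close> by (auto simp: U_def)
          then have "[k = i] (mod int q)"
            using that(1) cong_add_rcancel by blast
          then show ?thesis
            using k sub[OF \<open>t < d\<close>] by (auto simp: cong_def)
        qed
        have y: "[y = X - \<delta> X y] (mod int q)" and w': "[w = X - \<delta> X w] (mod int q)"
          using f_cong[of _ 1] by (auto simp: f_def)
        have x: "[x = X - \<delta> X w + \<delta> x w] (mod int q)"
          using f_cong[of x 0] by (simp add: f_def algebra_simps)
        have xU: "x \<in> U 0" and yU: "y \<in> U 1"
          using that 4 by auto
        \<comment> \<open>In the window \<open>x\<close> would lie strictly below \<open>y\<close>,
          so the way down from \<open>x\<close> to \<open>y\<close> goes around once. With
          \<open>\<delta>_le\<close> this yields the last order condition of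
          \<open>not_interleaved\<close>.\<close>
        have "\<delta> x y = (X - \<delta> X w + \<delta> x w) - (X - \<delta> X y) + int q"
        proof (rule \<delta>_unique)
          have "[x - y = (X - \<delta> X w + \<delta> x w) - (X - \<delta> X y)] (mod int q)"
            by (rule cong_diff[OF x y])
          then show "[x - y = (X - \<delta> X w + \<delta> x w) - (X - \<delta> X y) + int q] (mod int q)"
            by (simp add: cong_def)
        qed (use less \<delta>_bounds(1)[of x w] \<delta>_bounds(1)[of X y] \<delta>_bounds(2)[of X w] in auto)
        moreover have "\<delta> x y \<le> int z"
          using \<delta>_le[OF xU yU] 4 by simp
        ultimately have "(X - \<delta> X w + \<delta> x w) + int q \<le> X - \<delta> X y + int z"
          by simp
        show False
        proof (rule not_interleaved)
          show "d = 2" "X - \<delta> X w \<le> X - \<delta> X w + \<delta> x w" "X - \<delta> X w + \<delta> x w < X - \<delta> X y"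
            "X - \<delta> X y \<le> X" "X \<le> X - \<delta> X w + int z"
            "(X - \<delta> X w + \<delta> x w) + int q \<le> X - \<delta> X y + int z"
            using \<open>(X - \<delta> X w + \<delta> x w) + int q \<le> X - \<delta> X y + int z\<close> less \<delta>_bounds \<delta>_le[OF X w] 4 by auto
          show "X mod int q \<in> S 0" "(X - \<delta> X w + \<delta> x w) mod int q \<in> S 0"
            using mod_U[of X X 0] mod_U[of x "X - \<delta> X w + \<delta> x w" 0] x X xU 4 by auto
          show "(X - \<delta> X y - 1) mod int q \<in> S 1" "(X - \<delta> X w - 1) mod int q \<in> S 1"
            using mod_U[of y "X - \<delta> X y - 1" 1] mod_U[of w "X - \<delta> X w - 1" 1] y w' w yU 4 by auto
        qed
      qed
    qed
  qed
  \<comment> \<open>Block \<open>t\<close> starts at the greatest depth reached by block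
    \<open>t - 1\<close>. The final value is \<open>z\<close> instead of a maximum, so that the
    differences add up to exactly \<open>z\<close>.\<close>
  define N where "N t = (if t = 0 then 0 else if t < d then Max (f (t - 1) ` U (t - 1)) else int z)" for t
  have N: "N t \<le> f t y" "f t y \<le> N (Suc t)" if "t < d" "y \<in> U t" for t y
  proof -
    show "N t \<le> f t y"
    proof (cases t)
      case 0
      then show ?thesis
        using f_nonneg that by (simp add: N_def)
    next
      case (Suc k)
      then have "\<forall>x\<in>U k. f k x \<le> f t y"
        using f_mono[of k t] that by auto
      then show ?thesis
        using Suc that U_ne[of k] U_fin[of k] by (simp add: N_def)
    qed
    show "f t y \<le> N (Suc t)"
      using f_le that U_fin[of t] by (auto simp: N_def)
  qed
  define a where "a t = nat (N (Suc t) - N t)" for t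
  have a: "int (a t) = N (Suc t) - N t" if "t < d" for t
  proof -
    have "U t \<noteq> {}"
      using U_ne that .
    then obtain y where "y \<in> U t"
      by auto
    then show ?thesis
      using N[OF that] by (fastforce simp: a_def)
  qed
  have sum_a: "(\<Sum>j<t. int (a j)) = N t" if "t \<le> d" for t
  proof -
    have "(\<Sum>j<t. int (a j)) = (\<Sum>j<t. N (Suc j) - N j)"
      using that a by (intro sum.cong) auto
    also have "\<dots> = N t - N 0"
      by (rule sum_lessThan_telescope)
    finally show ?thesis
      by (simp add: N_def)
  qed
  show ?thesis
  proof
    have "int (\<Sum>t<d. a t) = int z"
      using sum_a[of d] d by (simp add: N_def)
    then show "(\<Sum>t<d. a t) = z"
      by (simp only: of_nat_eq_iff)
    fix t assume t: "t < d"
    show "S t \<subseteq> cyc_interval q (X - int t - (\<Sum>j<Suc t. int (a j))) (X - int t - (\<Sum>j<t. int (a j)))"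
    proof
      fix i assume i: "i \<in> S t"
      then have iU: "i + int t \<in> U t"
        by (auto simp: U_def)
      define g where "g = f t (i + int t)"
      have "[i + int t - int t = X - g - int t] (mod int q)"
        unfolding g_def by (intro cong_diff f_cong cong_refl)
      then have "i = (X - g - int t) mod int q"
        using i sub[OF t] by (auto simp: cong_def)
      moreover have "N t \<le> g" "g \<le> N (Suc t)"
        using N[OF t iU] by (auto simp: g_def)
      ultimately show "i \<in> cyc_interval q (X - int t - (\<Sum>j<Suc t. int (a j))) (X - int t - (\<Sum>j<t. int (a j)))"
        using sum_a[of t] sum_a[of "Suc t"] t unfolding cyc_interval_def by (intro image_eqI) auto
    qed
  qed
qed

end

section \<open>The characterization\<close>

lemma cyc_interval_cong:
  assumes "[x = x'] (mod int q)"
  shows "cyc_interval q x (x + l) = cyc_interval q x' (x' + l)"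
proof -
  have sub: "cyc_interval q x (x + l) \<subseteq> cyc_interval q x' (x' + l)" if "[x = x'] (mod int q)" for x x'
  proof
    fix i assume "i \<in> cyc_interval q x (x + l)"
    then obtain k where k: "x \<le> k" "k \<le> x + l" "i = k mod int q"
      by (auto simp: cyc_interval_def)
    have "[k - x + x = k - x + x'] (mod int q)"
      using that by (intro cong_add cong_refl)
    then have "i = (k - x + x') mod int q"
      using k by (simp add: cong_def)
    then show "i \<in> cyc_interval q x' (x' + l)"
      using k unfolding cyc_interval_def by (intro image_eqI) auto
  qed
  show ?thesis
    using sub[OF assms] sub[OF cong_sym[OF assms]] by blast
qed

theorem theorem3p4:
  fixes q d z :: nat and S :: "nat \<Rightarrow> int set"
  assumes "q \<ge> 2" and "d \<ge> 2" and "1 \<le> z" and "z \<le> q - 1" and "gcd q z = 1"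
    and "\<And>t. t < d \<Longrightarrow> S t \<noteq> {}"
    and "\<And>t. t < d \<Longrightarrow> S t \<subseteq> {0..<int q}"
  shows "typeII_admissible q d z S \<longleftrightarrow>
    (\<exists>(a :: nat \<Rightarrow> nat) (\<rho> :: int).
      (\<Sum>t = 0..<d. a t) = z \<and> \<rho> \<in> {0..<int q} \<and>
      S 0 \<subseteq> cyc_interval q \<rho> (\<rho> + int (a 0)) \<and>
      (\<forall>t \<in> {1..d - 1}.
        S t \<subseteq> cyc_interval q
          (\<rho> - (\<Sum>j = 1..t. (int (a j) + 1)))
          (\<rho> - (\<Sum>j = 1..t. (int (a j) + 1)) + int (a t))))"
  (is "_ \<longleftrightarrow> (\<exists>a \<rho>. ?R a \<rho>)")
proof -
  interpret typeII q d z S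
    using assms by unfold_locales auto
  have sum_Suc: "(\<Sum>j<Suc t. int (a j)) = int (a 0) + (\<Sum>j = 1..t. int (a j) + 1) - int t"
    for a :: "nat \<Rightarrow> nat" and t
    by (induction t) (auto simp: algebra_simps)
  \<comment> \<open>\<open>X\<close> is the upper and \<open>\<rho>\<close> the lower end of the
    interval of \<open>S 0\<close>, whence \<open>\<rho> = X - a 0\<close> modulo \<open>q\<close>.
    The summands \<open>+ 1\<close> of the statement amount to the block offset
    \<open>t\<close>.\<close>
  have interval: "cyc_interval q (X - int t - (\<Sum>j<Suc t. int (a j))) (X - int t - (\<Sum>j<t. int (a j))) =
    cyc_interval q (\<rho> - (\<Sum>j = 1..t. (int (a j) + 1))) (\<rho> - (\<Sum>j = 1..t. (int (a j) + 1)) + int (a t))"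
    if "[\<rho> = X - int (a 0)] (mod int q)" for X \<rho> a t
  proof -
    define s where "s = (\<Sum>j = 1..t. int (a j) + 1)"
    have "[X - int (a 0) - s = \<rho> - s] (mod int q)"
      using that by (intro cong_diff cong_refl cong_sym[OF that])
    moreover have "X - int t - (\<Sum>j<t. int (a j)) = X - int (a 0) - s + int (a t)"
      using sum_Suc[of a t] by (simp add: s_def)
    moreover have "X - int t - (\<Sum>j<Suc t. int (a j)) = X - int (a 0) - s"
      using sum_Suc[of a t] by (simp add: s_def)
    ultimately show ?thesis
      using cyc_interval_cong unfolding s_def by metis
  qed
  have R_iff: "?R a \<rho> \<longleftrightarrow> (\<Sum>t<d. a t) = z \<and> \<rho> \<in> {0..<int q} \<and>
    (\<forall>t<d. S t \<subseteq> cyc_interval q (X - int t - (\<Sum>j<Suc t. int (a j))) (X - int t - (\<Sum>j<t. int (a j))))"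
    if "[\<rho> = X - int (a 0)] (mod int q)" for a \<rho> X
  proof -
    have split: "(\<forall>t<d. P t) \<longleftrightarrow> P 0 \<and> (\<forall>t\<in>{1..d - 1}. P t)" for P
      using d by (metis One_nat_def Suc_diff_1 Suc_leI atLeastAtMost_iff bot_nat_0.not_eq_extremum less_Suc_eq_le order_less_le_trans zero_less_numeral)
    show ?thesis
      unfolding interval[where \<rho> = \<rho> and X = X and a = a, OF that] split by (simp add: lessThan_atLeast0)
  qed
  show ?thesis
  proof
    assume "typeII_admissible q d z S"
    then interpret admissible q d z S
      by unfold_locales
    obtain a X where aX: "(\<Sum>t<d. a t) = z" "\<And>t. t < d \<Longrightarrow>
      S t \<subseteq> cyc_interval q (X - int t - (\<Sum>j<Suc t. int (a j))) (X - int t - (\<Sum>j<t. int (a j)))"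
      using exists_intervals by blast
    have "[(X - int (a 0)) mod int q = X - int (a 0)] (mod int q)"
      by (simp add: cong_def)
    from R_iff[where a = a and X = X, OF this] have "?R a ((X - int (a 0)) mod int q)"
      using aX q by simp
    then show "\<exists>a \<rho>. ?R a \<rho>"
      by blast
  next
    assume "\<exists>a \<rho>. ?R a \<rho>"
    then obtain a \<rho> where "?R a \<rho>"
      by blast
    then have "separated q d z S a (\<rho> + int (a 0))"
      using R_iff[of \<rho> "\<rho> + int (a 0)" a] by unfold_locales auto
    then show "typeII_admissible q d z S"
      by (rule separated.admissible)
  qed
qed

end
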